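(* Let $\mu_A$ and $\mu_B$ be compactly supported probability measures on $\mathbb{R}$. Then for all sufficiently small $\theta$, $$R_{\mu_B\boxplus\mu_A}(\theta)=R_{\mu_A}(\theta)+R_{\mu_B}(\theta),$$ where $\boxplus$ denotes the free convolution of measures.
   Context: The free convolution $\mu_A\boxplus\mu_B$ of compactly supported probability measures is the distribution of $a+b$, where $a,b$ are freely independent self-adjoint non-commutative random variables with distributions $\mu_A,\mu_B$; it is also the almost sure weak limit of the spectral measure of $A_N+UB_NU^*$ when $A_N,B_N$ are uniformly bounded real diagonal matrices with spectral measures converging to $\mu_A$ and $\mu_B$ and $U$ is Haar distributed on the orthogonal (or unitary) group. For a compactly supported probability measure $\mu$ on $\mathbb{R}$, $H_\mu(z)=\int\frac1{z-\lambda}\,d\mu(\lambda)$; $K_\mu$ is the inverse of the (injective) restriction of $H_\mu$ to the complement in $\mathbb{R}$ of the smallest closed interval containing $\mathrm{supp}(\mu)$, and $R_\mu(\gamma)=K_\mu(\gamma)-\frac1\gamma$ for $\gamma$ in the image of this restriction, which contains all sufficiently small $\gamma\ne0$; $R_\mu(0)=\int\lambda\,d\mu(\lambda)$. *)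

theory Defs
  imports "HOL-Probability.Probability"
begin

section \<open>Compactly supported measures and the R-transform\<close>

definition measure_support :: "real measure \<Rightarrow> real set" where
  "measure_support \<mu> = {x. \<forall>U. open U \<and> x \<in> U \<longrightarrow> measure \<mu> U > 0}"

definition compactly_supported_prob :: "real measure \<Rightarrow> bool" where
  "compactly_supported_prob \<mu> \<longleftrightarrow>
     prob_space \<mu> \<and> sets \<mu> = sets borel \<and> compact (measure_support \<mu>)"

(* For a compactly supported probability measure the support is compact and nonempty,
   so this is the smallest closed interval containing it. *)
definition support_interval :: "real measure \<Rightarrow> real set" where
  "support_interval \<mu> = {Inf (measure_support \<mu>)..Sup (measure_support \<mu>)}"

definition H_transform :: "real measure \<Rightarrow> real \<Rightarrow> real" where
  "H_transform \<mu> z = (LINT x|\<mu>. 1 / (z - x))"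

(* K and R are meaningful on the image of - support_interval under H_transform
   (together with 0 for R); the image contains a punctured neighbourhood of 0.
   Outside it, inv_into returns an unspecified value. *)
definition K_transform :: "real measure \<Rightarrow> real \<Rightarrow> real" where
  "K_transform \<mu> = inv_into (- support_interval \<mu>) (H_transform \<mu>)"

definition R_transform :: "real measure \<Rightarrow> real \<Rightarrow> real" where
  "R_transform \<mu> \<gamma> =
     (if \<gamma> = 0 then (LINT x|\<mu>. x) else K_transform \<mu> \<gamma> - 1 / \<gamma>)"

section \<open>Non-commutative probability spaces and free convolution\<close>

(* A unital complex *-algebra, carried by the whole type, with a state \<phi>.
   Neither traciality nor faithfulness of \<phi> is required, and no C*-norm. *)
locale nc_probability_space = vector_space scale
  for scale :: "complex \<Rightarrow> 'a::ring_1 \<Rightarrow> 'a" +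
  fixes star :: "'a \<Rightarrow> 'a" and \<phi> :: "'a \<Rightarrow> complex"
  assumes scale_mult_left: "scale c x * y = scale c (x * y)"
    and scale_mult_right: "x * scale c y = scale c (x * y)"
    and star_add: "star (x + y) = star x + star y"
    and star_scale: "star (scale c x) = scale (cnj c) (star x)"
    and star_mult: "star (x * y) = star y * star x"
    and star_star: "star (star x) = x"
    and state_add: "\<phi> (x + y) = \<phi> x + \<phi> y"
    and state_scale: "\<phi> (scale c x) = c * \<phi> x"
    and state_one: "\<phi> 1 = 1"
    and state_pos: "\<phi> (star x * x) \<in> \<real>\<^sub>\<ge>\<^sub>0"
begin

definition unital_subalgebra :: "'a set \<Rightarrow> bool" where
  "unital_subalgebra B \<longleftrightarrow> subspace B \<and> 1 \<in> B \<and> (\<forall>x\<in>B. \<forall>y\<in>B. x * y \<in> B)"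

(* Freeness of a family of self-adjoint variables: an alternating product of centred
   elements of the generated unital algebras has vanishing expectation. The list js
   records which algebra each factor of xs is taken from. For self-adjoint a the
   generated algebra is already closed under star. *)
definition freely_independent :: "('i \<Rightarrow> 'a) \<Rightarrow> 'i set \<Rightarrow> bool" where
  "freely_independent a I \<longleftrightarrow>
     (\<forall>i\<in>I. star (a i) = a i) \<and>
     (\<forall>js xs. js \<noteq> [] \<and> set js \<subseteq> I \<and> distinct_adj js \<and> length xs = length js \<and>
        (\<forall>k<length js. xs ! k \<in> unital_subalgebra hull {a (js ! k)} \<and> \<phi> (xs ! k) = 0)
        \<longrightarrow> \<phi> (prod_list xs) = 0)"

(* A compactly supported law is determined by its moments. *)
definition has_distribution :: "'a \<Rightarrow> real measure \<Rightarrow> bool" where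
  "has_distribution a \<mu> \<longleftrightarrow>
     star a = a \<and> compactly_supported_prob \<mu> \<and>
     (\<forall>k. \<phi> (a ^ k) = of_real (LINT x|\<mu>. x ^ k))"

(* \<mu> is the free convolution of \<mu>\<^sub>1 and \<mu>\<^sub>2, realised in the given space. *)
definition is_free_convolution ::
    "real measure \<Rightarrow> real measure \<Rightarrow> real measure \<Rightarrow> bool" where
  "is_free_convolution \<mu>\<^sub>1 \<mu>\<^sub>2 \<mu> \<longleftrightarrow>
     (\<exists>a b. freely_independent (\<lambda>i. if i then a else b) {True, False} \<and>
        has_distribution a \<mu>\<^sub>1 \<and> has_distribution b \<mu>\<^sub>2 \<and> has_distribution (a + b) \<mu>)"

end

end

theory Submission
  imports Defs "HOL-Complex_Analysis.Complex_Analysis"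
begin

text \<open>The proof is Haagerup's resolvent argument, carried out in formal power series. Suppose
\<open>\<phi> ((K\<^sub>a - a)\<^sup>-\<^sup>1) = \<gamma> = \<phi> ((K\<^sub>b - b)\<^sup>-\<^sup>1)\<close>, and write the two resolvents as
\<open>\<gamma> (1 + x)\<close> and \<open>\<gamma> (1 + y)\<close>. Then \<open>x\<close> and \<open>y\<close> are centred elements of
the algebras generated by \<open>a\<close> and by \<open>b\<close>, and
\[ K_a + K_b - 1/\gamma - (a + b) = \gamma^{-1} (1 + x)^{-1} (1 - x y) (1 + y)^{-1}. \]
The inverse of the right-hand side is \<open>\<gamma> (1 + y) (1 + x y + x y x y + \<dots>) (1 + x)\<close>. Every term
of its expansion, apart from the leading \<open>\<gamma>\<close>, is \<open>\<gamma>\<close> times an alternating product of centred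
elements, so by freeness its state is \<open>\<gamma>\<close>. Hence \<open>K\<^sub>a + K\<^sub>b - 1/\<gamma>\<close> is a point
at which the transform \<open>H\<close> of \<open>a + b\<close> takes the value \<open>\<gamma>\<close>, which is the additivity of \<open>R\<close>.

The algebra carries no topology, so resolvents are taken among the power series in a central
variable \<open>X = \<gamma>\<close> with coefficients in the algebra. Since \<open>K\<close> has a simple pole at \<open>0\<close>, it is
represented by the series \<open>p = \<gamma> K\<close>, which has constant term \<open>1\<close>; up to a factor \<open>\<gamma>\<close>, the resolvent of \<open>c\<close> becomes the
inverse of the pencil \<open>p - X c\<close>, and the sum of two variables corresponds to
\<open>p + r - 1\<close>. In terms of the moment series \<open>G(w) = H(1/w)\<close>, expanded at \<open>w = 0\<close>, the equation
\<open>H(K(\<gamma>)) = \<gamma>\<close> says that \<open>G\<close> composed with \<open>X / p\<close> is \<open>X\<close>. The formal additivity is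
\<open>cauchy_series_sum_free\<close>.

To return to functions, compactness of the support makes \<open>G\<close> convergent near \<open>0\<close>, where it has a holomorphic local
inverse (\<open>cauchy_fps_inverse_exists\<close>), so \<open>p\<close> and \<open>r\<close> converge. Because \<open>H\<close> is injective off the support
interval (\<open>inj_on_H_transform\<close>), any convergent solution of the composition equation computes
\<open>K\<close> near \<open>0\<close> (\<open>K_transform_eq_reciprocal\<close>); this also applies to the solution \<open>p + r - 1\<close> for the free convolution.\<close>

section \<open>Power series over a non-commutative probability space\<close>

lemma fps_power_nth_eq_0: "fps_nth w 0 = 0 \<Longrightarrow> n < k \<Longrightarrow> fps_nth (w ^ k) n = 0"
  for w :: "'a::comm_ring_1 fps"
  using startsby_zero_power_prefix by blast

context nc_probability_space
begin

lemma state_0 [simp]: "\<phi> 0 = 0"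
  using state_add[of 0 0] by simp

lemma state_sum: "\<phi> (sum f A) = (\<Sum>i\<in>A. \<phi> (f i))"
  by (induction A rule: infinite_finite_induct) (auto simp: state_add)

lemma scale_one_mult: "scale r 1 * x = scale r x"
  by (simp add: scale_mult_left)

lemma mult_scale_one: "x * scale r 1 = scale r x"
  by (simp add: scale_mult_right)

definition embed_fps :: "complex fps \<Rightarrow> 'a fps" where
  "embed_fps r = Abs_fps (\<lambda>n. scale (fps_nth r n) 1)"

definition state_fps :: "'a fps \<Rightarrow> complex fps" where
  "state_fps f = Abs_fps (\<lambda>n. \<phi> (fps_nth f n))"

lemma nth_embed [simp]: "fps_nth (embed_fps r) n = scale (fps_nth r n) 1"
  by (simp add: embed_fps_def)

lemma nth_state_fps [simp]: "fps_nth (state_fps f) n = \<phi> (fps_nth f n)"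
  by (simp add: state_fps_def)

lemma nth_embed_mult:
  "fps_nth (embed_fps r * f) n = (\<Sum>i=0..n. scale (fps_nth r i) (fps_nth f (n - i)))"
  by (simp add: fps_mult_nth scale_one_mult)

lemma embed_1 [simp]: "embed_fps 1 = 1"
  by (simp add: fps_eq_iff)

lemma embed_X [simp]: "embed_fps fps_X = fps_X"
  by (simp add: fps_eq_iff fps_X_def)

lemma embed_add: "embed_fps (r + s) = embed_fps r + embed_fps s"
  by (simp add: fps_eq_iff scale_left_distrib)

lemma embed_diff: "embed_fps (r - s) = embed_fps r - embed_fps s"
  by (simp add: fps_eq_iff scale_left_diff_distrib)

lemma embed_mult: "embed_fps (r * s) = embed_fps r * embed_fps s"
  by (rule fps_ext) (simp add: fps_mult_nth scale_one_mult scale_sum_left)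

lemma embed_commute: "embed_fps r * f = f * embed_fps r"
proof (rule fps_ext)
  fix n
  have "fps_nth (f * embed_fps r) n = (\<Sum>i=0..n. scale (fps_nth r (n - i)) (fps_nth f i))"
    by (simp add: fps_mult_nth mult_scale_one)
  also have "\<dots> = (\<Sum>i=0..n. scale (fps_nth r i) (fps_nth f (n - i)))"
    by (rule sum.reindex_bij_witness[of _ "\<lambda>i. n - i" "\<lambda>i. n - i"]) auto
  finally show "fps_nth (embed_fps r * f) n = fps_nth (f * embed_fps r) n"
    by (simp add: nth_embed_mult)
qed

lemma state_fps_embed_mult: "state_fps (embed_fps r * f) = r * state_fps f"
  by (rule fps_ext) (simp add: fps_mult_nth scale_one_mult state_sum state_scale)

definition moment_series :: "'a \<Rightarrow> complex fps" where
  "moment_series c = Abs_fps (\<lambda>k. \<phi> (c ^ k))"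

definition cauchy_series :: "'a \<Rightarrow> complex fps" where
  "cauchy_series c = fps_X * moment_series c"

definition geometric_fps :: "'a \<Rightarrow> complex fps \<Rightarrow> 'a fps" where
  "geometric_fps c w = Abs_fps (\<lambda>n. \<Sum>k\<le>n. scale (fps_nth (w ^ k) n) (c ^ k))"

text \<open>Any upper bound beyond the degree may be used for the summation, so one common bound can serve
several coefficients at once.\<close>

lemma nth_geometric:
  assumes "fps_nth w 0 = 0" "n \<le> N"
  shows "fps_nth (geometric_fps c w) n = (\<Sum>k\<le>N. scale (fps_nth (w ^ k) n) (c ^ k))"
  unfolding geometric_fps_def fps_nth_Abs_fps
  by (rule sum.mono_neutral_left) (use assms in \<open>auto simp: fps_power_nth_eq_0\<close>)

lemma geometric_commute: "fps_const c * geometric_fps c w = geometric_fps c w * fps_const c"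
  by (rule fps_ext)
     (simp add: geometric_fps_def sum_distrib_left sum_distrib_right scale_mult_left
        scale_mult_right power_commutes)

text \<open>The series \<open>\<Sum> w\<^sup>k c\<^sup>k\<close> is summable because \<open>w\<close> has no constant term, so only finitely many powers
contribute to each coefficient. This is the recursion that makes it an inverse of \<open>1 - w c\<close>.\<close>

lemma geometric_recursion:
  assumes w: "fps_nth w 0 = 0"
  shows "embed_fps w * fps_const c * geometric_fps c w = geometric_fps c w - 1"
proof (rule fps_ext)
  fix n
  have "fps_nth (embed_fps w * fps_const c * geometric_fps c w) n =
      (\<Sum>i=0..n. scale (fps_nth w i) (c * (\<Sum>k\<le>n. scale (fps_nth (w ^ k) (n - i)) (c ^ k))))"
    by (simp add: mult.assoc nth_embed_mult nth_geometric[OF w, of _ n])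
  also have "\<dots> = (\<Sum>i=0..n. \<Sum>k\<le>n. scale (fps_nth w i * fps_nth (w ^ k) (n - i)) (c ^ Suc k))"
    by (simp add: sum_distrib_left scale_mult_right scale_sum_right)
  also have "\<dots> = (\<Sum>k\<le>n. scale (fps_nth (w ^ Suc k) n) (c ^ Suc k))"
    by (subst sum.swap) (simp add: fps_mult_nth scale_sum_left)
  also have "\<dots> = (\<Sum>k\<le>Suc n. scale (fps_nth (w ^ k) n) (c ^ k)) - scale (fps_nth (w ^ 0) n) (c ^ 0)"
    by (subst sum.atMost_Suc_shift) simp
  also have "\<dots> = fps_nth (geometric_fps c w - 1) n"
    by (simp only: nth_geometric[OF w, of n "Suc n"] fps_sub_nth) simp
  finally show "fps_nth (embed_fps w * fps_const c * geometric_fps c w) n =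
      fps_nth (geometric_fps c w - 1) n" .
qed

lemma state_fps_geometric: "state_fps (geometric_fps c w) = moment_series c oo w"
  by (rule fps_ext)
     (simp add: geometric_fps_def moment_series_def state_sum state_scale fps_compose_nth
        atMost_atLeast0 mult.commute)

text \<open>With \<open>p = X K(X)\<close> this is \<open>X (K(X) - c)\<close>: multiplying by \<open>X\<close> removes the pole of \<open>K\<close>, so that
the pencil is an honest power series, invertible because its constant term is a nonzero scalar.\<close>

definition pencil :: "complex fps \<Rightarrow> 'a \<Rightarrow> 'a fps" where
  "pencil p c = embed_fps p - fps_X * fps_const c"

text \<open>Pulling the scalar series \<open>p\<close> out of \<open>p - X c\<close> leaves \<open>1 - (X / p) c\<close>, which a geometric series inverts.\<close>

definition pencil_inverse :: "complex fps \<Rightarrow> 'a \<Rightarrow> 'a fps" where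
  "pencil_inverse p c = embed_fps (inverse p) * geometric_fps c (fps_X * inverse p)"

lemma pencil_inverse:
  assumes "fps_nth p 0 \<noteq> 0"
  shows "pencil p c * pencil_inverse p c = 1" "pencil_inverse p c * pencil p c = 1"
proof -
  define v where "v = inverse p"
  define E where "E = geometric_fps c (fps_X * v)"
  have vp: "v * p = 1"
    using assms by (simp add: v_def inverse_mult_eq_1)
  have e: "embed_fps v * embed_fps p = 1"
    by (simp flip: embed_mult add: vp)
  have ev: "embed_fps v * pencil p c = 1 - embed_fps (fps_X * v) * fps_const c"
    by (simp add: pencil_def right_diff_distrib e embed_mult mult.assoc flip: fps_mult_fps_X_commute)
       (metis embed_X embed_commute mult.assoc)
  have w0: "fps_nth (fps_X * v) 0 = 0"
    by simp
  note rec = geometric_recursion[OF w0, of c, folded E_def]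
  have E1: "embed_fps v * pencil p c * E = 1"
    by (simp add: ev left_diff_distrib rec)
  have comm: "E * (embed_fps (fps_X * v) * fps_const c) = embed_fps (fps_X * v) * fps_const c * E"
    by (metis E_def embed_commute geometric_commute mult.assoc)
  have E2: "E * (embed_fps v * pencil p c) = 1"
    by (simp add: ev right_diff_distrib comm rec)
  show "pencil p c * pencil_inverse p c = 1"
    using E1 unfolding pencil_inverse_def v_def[symmetric] E_def[symmetric]
    by (metis embed_commute mult.assoc)
  show "pencil_inverse p c * pencil p c = 1"
    using E2 unfolding pencil_inverse_def v_def[symmetric] E_def[symmetric]
    by (metis embed_commute mult.assoc)
qed

text \<open>The formal version of \<open>H(K(\<gamma>)) = \<gamma>\<close>: applying the state to the geometric series turns powers of \<open>c\<close>
into moments, so the state of the resolvent is the moment series evaluated at \<open>X / p\<close>.\<close>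

lemma cauchy_compose_eq_X_iff:
  "cauchy_series c oo (fps_X * inverse p) = fps_X \<longleftrightarrow> state_fps (pencil_inverse p c) = 1"
proof -
  have "cauchy_series c oo (fps_X * inverse p) = fps_X * state_fps (pencil_inverse p c)"
    by (simp add: cauchy_series_def fps_compose_mult_distrib pencil_inverse_def
        state_fps_embed_mult state_fps_geometric mult.assoc)
  moreover have "fps_X * f = fps_X \<longleftrightarrow> f = 1" for f :: "complex fps"
    using mult_cancel_left[of fps_X f 1] by simp
  ultimately show ?thesis
    by simp
qed

definition centred_elements :: "'a \<Rightarrow> 'a set" where
  "centred_elements c = {x \<in> unital_subalgebra hull {c}. \<phi> x = 0}"

lemma nth_pencil_inverse_in_hull:
  "fps_nth (pencil_inverse p c) n \<in> unital_subalgebra hull {c}"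
proof -
  have "fps_nth (pencil_inverse p c) n \<in> B" if B: "unital_subalgebra B" "c \<in> B" for B
  proof -
    have sub: "subspace B" and one: "1 \<in> B" and mult: "\<And>x y. x \<in> B \<Longrightarrow> y \<in> B \<Longrightarrow> x * y \<in> B"
      using B by (auto simp: unital_subalgebra_def)
    have "c ^ k \<in> B" for k
      by (induction k) (auto intro: one mult B)
    then show ?thesis
      unfolding pencil_inverse_def nth_embed_mult geometric_fps_def fps_nth_Abs_fps
      by (intro subspace_sum[OF sub] subspace_scale[OF sub])
  qed
  then show ?thesis
    by (auto simp: hull_def)
qed

lemma nth_pencil_inverse_centred:
  assumes "state_fps (pencil_inverse p c) = 1"
  shows "fps_nth (pencil_inverse p c - 1) n \<in> centred_elements c"
proof -
  have "fps_nth (pencil_inverse p c - 1) n \<in> B" if B: "unital_subalgebra B" "c \<in> B" for B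
  proof -
    have sub: "subspace B" and one: "1 \<in> B"
      using B by (auto simp: unital_subalgebra_def)
    have "fps_nth (pencil_inverse p c) n \<in> B"
      using nth_pencil_inverse_in_hull[of p c n] B by (auto simp: hull_def)
    moreover have "fps_nth 1 n \<in> B"
      using one subspace_0[OF sub] by simp
    ultimately show ?thesis
      using subspace_diff[OF sub] by simp
  qed
  moreover have "\<phi> (fps_nth (pencil_inverse p c - 1) n) = 0"
  proof -
    have "\<phi> (fps_nth (pencil_inverse p c) n) = fps_nth 1 n"
      using assms by (metis nth_state_fps)
    moreover have "\<phi> (x - y) = \<phi> x - \<phi> y" for x y
      using state_add[of "x - y" y] by simp
    ultimately show ?thesis
      by (simp add: state_one)
  qed
  ultimately show ?thesis
    by (auto simp: centred_elements_def hull_def)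
qed

lemma nth_0_pencil_inverse: "fps_nth p 0 = 1 \<Longrightarrow> fps_nth (pencil_inverse p c) 0 = 1"
  by (simp add: pencil_inverse_def geometric_fps_def)

text \<open>Freeness in a form suited to lists that are built by appending: the index \<open>True\<close> stands for \<open>a\<close>
and \<open>False\<close> for \<open>b\<close>.\<close>

lemma state_alternating_product:
  assumes free: "freely_independent (\<lambda>i. if i then a else b) {True, False}"
    and "js \<noteq> []" "distinct_adj js"
    and "list_all2 (\<lambda>j x. x \<in> centred_elements (if j then a else b)) js xs"
  shows "\<phi> (prod_list xs) = 0"
proof -
  have "set js \<subseteq> {True, False}"
    by auto
  moreover have "length xs = length js"
    using assms(4) by (simp add: list_all2_lengthD)
  moreover have "\<forall>k<length js. xs ! k \<in> unital_subalgebra hull {if js ! k then a else b} \<and> \<phi> (xs ! k) = 0"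
    using list_all2_nthD[OF assms(4)] by (auto simp: centred_elements_def)
  ultimately show ?thesis
    using free assms(2,3) unfolding freely_independent_def by blast
qed

text \<open>The series \<open>q = (1 - x y)\<^sup>-\<^sup>1 (1 + x)\<close> is \<open>1\<close> plus a sum of alternating words in centred elements that
start with a coefficient of \<open>x\<close>. They stay alternating after an alternating prefix that does not end
in the algebra of \<open>a\<close>, so only the summand \<open>1\<close> survives the state. Carrying the prefix along
makes an induction on the degree possible without expanding \<open>q\<close> into words: in the recursion
\<open>q = 1 + x + x y q\<close> the factors \<open>x\<close> and \<open>y\<close> are absorbed into the prefix, and the degree drops
since \<open>x\<close> has no constant term.\<close>

lemma state_alternating_times_inverse:
  assumes free: "freely_independent (\<lambda>i. if i then a else b) {True, False}"
    and x: "\<And>n. fps_nth x n \<in> centred_elements a" and x0: "fps_nth x 0 = 0"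
    and y: "\<And>n. fps_nth y n \<in> centred_elements b"
    and q: "(1 - x * y) * q = 1 + x"
    and js: "distinct_adj js" "js = [] \<or> \<not> last js"
    and xs: "list_all2 (\<lambda>j x. x \<in> centred_elements (if j then a else b)) js xs"
  shows "\<phi> (prod_list xs * fps_nth q n) = (if n = 0 then \<phi> (prod_list xs) else 0)"
  using js xs
proof (induction n arbitrary: js xs rule: less_induct)
  case (less n)
  have "q = 1 + x + x * (y * q)"
    using q by (simp add: algebra_simps)
  then have "fps_nth q n = fps_nth (1 + x + x * (y * q)) n"
    by simp
  then have qn: "fps_nth q n = (if n = 0 then 1 else 0) + fps_nth x n +
      (\<Sum>i=0..n. \<Sum>j=0..n - i. fps_nth x i * fps_nth y j * fps_nth q (n - i - j))"
    by (simp add: fps_mult_nth sum_distrib_left mult.assoc)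
  have "\<phi> (prod_list (xs @ [fps_nth x n])) = 0"
    using less.prems x
    by (intro state_alternating_product[OF free, of "js @ [True]"] list_all2_appendI)
       (auto simp: distinct_adj_append_iff)
  then have 1: "\<phi> (prod_list xs * fps_nth x n) = 0"
    by simp
  have 2: "\<phi> (prod_list xs * (fps_nth x i * fps_nth y j * fps_nth q (n - i - j))) = 0"
    if ij: "i \<le> n" "j \<le> n - i" for i j
  proof (cases "i = 0")
    case False
    let ?js = "js @ [True, False]" and ?xs = "xs @ [fps_nth x i, fps_nth y j]"
    have da: "distinct_adj ?js"
      using less.prems by (auto simp: distinct_adj_append_iff)
    have la: "list_all2 (\<lambda>j x. x \<in> centred_elements (if j then a else b)) ?js ?xs"
      using less.prems x y by (intro list_all2_appendI) auto
    have "\<phi> (prod_list ?xs * fps_nth q (n - i - j)) = (if n - i - j = 0 then \<phi> (prod_list ?xs) else 0)"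
      by (rule less.IH[OF _ da _ la]) (use False ij in auto)
    also have "\<phi> (prod_list ?xs) = 0"
      by (rule state_alternating_product[OF free _ da la]) simp
    finally show ?thesis
      by (simp add: mult.assoc)
  qed (simp add: x0)
  have "\<phi> (prod_list xs * (\<Sum>i=0..n. \<Sum>j=0..n - i. fps_nth x i * fps_nth y j * fps_nth q (n - i - j))) = 0"
    unfolding sum_distrib_left state_sum by (intro sum.neutral ballI) (rule 2; simp)
  then show ?case
    by (subst qn) (simp add: distrib_left state_add 1)
qed

text \<open>Haagerup's identity. With \<open>P' = P\<^sup>-\<^sup>1\<close> and \<open>Q' = Q\<^sup>-\<^sup>1\<close> one has \<open>P (P' - 1) = 1 - P\<close> and
\<open>(Q' - 1) Q = 1 - Q\<close>, so the right-hand side is \<open>P Q - (1 - P) (1 - Q) = P + Q - 1\<close>.\<close>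

lemma pencil_sum_factorization:
  fixes a b :: 'a
  assumes p: "fps_nth p 0 \<noteq> 0" and r: "fps_nth r 0 \<noteq> 0"
  shows "pencil (p + r - 1) (a + b) =
    pencil p a * (1 - (pencil_inverse p a - 1) * (pencil_inverse r b - 1)) * pencil r b"
proof -
  define P Q P' Q' where defs: "P = pencil p a" "Q = pencil r b"
    "P' = pencil_inverse p a" "Q' = pencil_inverse r b"
  have *: "P * P' = 1" "Q' * Q = 1"
    using pencil_inverse[OF p] pencil_inverse[OF r] by (simp_all add: defs)
  have "P * (1 - (P' - 1) * (Q' - 1)) * Q = P * Q - (P * P' - P) * (Q' * Q - Q)"
    by (simp add: algebra_simps)
  also have "\<dots> = P + Q - 1"
    by (simp add: * algebra_simps)
  also have "\<dots> = pencil (p + r - 1) (a + b)"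
    by (simp add: defs pencil_def embed_add embed_diff distrib_left flip: fps_const_add)
  finally show ?thesis
    by (simp add: defs)
qed

text \<open>Additivity of the R-transform at the level of formal power series: if \<open>p = 1 + X R\<^sub>a\<close> and
\<open>r = 1 + X R\<^sub>b\<close>, then \<open>p + r - 1 = 1 + X (R\<^sub>a + R\<^sub>b)\<close>.\<close>

theorem cauchy_series_sum_free:
  assumes free: "freely_independent (\<lambda>i. if i then a else b) {True, False}"
    and p: "fps_nth p 0 = 1" and r: "fps_nth r 0 = 1"
    and ca: "cauchy_series a oo (fps_X * inverse p) = fps_X"
    and cb: "cauchy_series b oo (fps_X * inverse r) = fps_X"
  shows "cauchy_series (a + b) oo (fps_X * inverse (p + r - 1)) = fps_X"
proof -
  define x where "x = pencil_inverse p a - 1"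
  define y where "y = pencil_inverse r b - 1"
  define t where "t = pencil_inverse (p + r - 1) (a + b)"
  define q where "q = pencil r b * t"
  have p0: "fps_nth p 0 \<noteq> 0" and r0: "fps_nth r 0 \<noteq> 0" and pr0: "fps_nth (p + r - 1) 0 \<noteq> 0"
    using p r by simp_all
  have "pencil p a * ((1 - x * y) * q) = 1"
    using pencil_inverse(1)[OF pr0, of "a + b"]
    by (simp add: pencil_sum_factorization[OF p0 r0] x_def y_def q_def t_def mult.assoc)
  then have "pencil_inverse p a * pencil p a * ((1 - x * y) * q) = pencil_inverse p a"
    by (simp add: mult.assoc)
  then have q: "(1 - x * y) * q = 1 + x"
    by (simp add: pencil_inverse(2)[OF p0] x_def)
  \<comment> \<open>The resolvent of \<open>a + b\<close> is \<open>(1 + y) q\<close>, and \<open>q\<close> is the series of the preceding alternating-word argument.\<close>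
  have "(1 + y) * q = pencil_inverse r b * pencil r b * t"
    by (simp add: y_def q_def mult.assoc)
  then have t: "t = q + y * q"
    by (simp add: pencil_inverse(2)[OF r0] distrib_right)
  have x: "fps_nth x n \<in> centred_elements a" and y: "fps_nth y n \<in> centred_elements b" for n
    using ca cb unfolding cauchy_compose_eq_X_iff x_def y_def by (simp_all only: nth_pencil_inverse_centred)
  have x0: "fps_nth x 0 = 0"
    using nth_0_pencil_inverse[OF p] by (simp add: x_def)
  note alternating = state_alternating_times_inverse[OF free x x0 y q]
  have "\<phi> (fps_nth q n) = (if n = 0 then 1 else 0)" for n
    using alternating[of "[]" "[]" n] by (simp add: state_one)
  moreover have "\<phi> (fps_nth y i * fps_nth q k) = 0" for i k
    using alternating[of "[False]" "[fps_nth y i]" k] y[of i] by (simp add: centred_elements_def)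
  ultimately have "state_fps t = 1"
    by (intro fps_ext) (simp add: t fps_mult_nth state_add state_sum)
  then show ?thesis
    by (simp add: cauchy_compose_eq_X_iff t_def)
qed

end

section \<open>The transform of a compactly supported measure off its support\<close>

text \<open>The complement of the support is a union of open null sets; by the Lindelof property countably many
of them suffice.\<close>

lemma AE_measure_support:
  assumes "prob_space \<mu>" "sets \<mu> = sets borel"
  shows "AE x in \<mu>. x \<in> measure_support \<mu>"
proof -
  interpret prob_space \<mu> by fact
  define F where "F = {U. open U \<and> measure \<mu> U = 0}"
  have compl: "- measure_support \<mu> = \<Union>F"
    by (auto simp: measure_support_def F_def not_less measure_le_0_iff) 
  obtain F' where F': "F' \<subseteq> F" "countable F'" "\<Union>F' = \<Union>F"
    using Lindelof[of F] by (auto simp: F_def)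
  have "(\<Union>U\<in>F'. U) \<in> null_sets \<mu>"
  proof (rule null_sets_UN'[OF F'(2)])
    fix U assume "U \<in> F'"
    then have "open U" "measure \<mu> U = 0"
      using F'(1) by (auto simp: F_def)
    then show "U \<in> null_sets \<mu>"
      using assms(2) by (auto simp: null_sets_def emeasure_eq_measure)
  qed
  then have "- measure_support \<mu> \<in> null_sets \<mu>"
    using compl F'(3) by simp
  then show ?thesis
    by (rule AE_I'[of _ _]) auto
qed

lemma
  assumes "compactly_supported_prob \<mu>"
  shows measure_support_nonempty: "measure_support \<mu> \<noteq> {}"
    and measure_support_subset: "measure_support \<mu> \<subseteq> support_interval \<mu>"
    and AE_support_interval: "AE x in \<mu>. x \<in> support_interval \<mu>"
proof -
  have ps: "prob_space \<mu>" "sets \<mu> = sets borel" and cpt: "compact (measure_support \<mu>)"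
    using assms by (auto simp: compactly_supported_prob_def)
  note AE = AE_measure_support[OF ps]
  show "measure_support \<mu> \<noteq> {}"
    using AE prob_space.AE_False[OF ps(1)] by auto
  have bdd: "bdd_above (measure_support \<mu>)" "bdd_below (measure_support \<mu>)"
    using compact_imp_bounded[OF cpt] bounded_imp_bdd_above bounded_imp_bdd_below by auto
  show sub: "measure_support \<mu> \<subseteq> support_interval \<mu>"
    using bdd by (auto simp: support_interval_def intro: cInf_lower cSup_upper)
  show "AE x in \<mu>. x \<in> support_interval \<mu>"
    using AE by eventually_elim (use sub in auto)
qed

lemma support_interval_bounded:
  assumes "compactly_supported_prob \<mu>"
  obtains C where "C > 0" "\<And>x. x \<in> support_interval \<mu> \<Longrightarrow> \<bar>x\<bar> \<le> C"
proof -
  have "bounded (support_interval \<mu>)"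
    by (simp add: support_interval_def)
  then show thesis
    using that by (auto simp: bounded_pos)
qed

lemma integrable_bounded_on_support:
  fixes f :: "real \<Rightarrow> real"
  assumes "compactly_supported_prob \<mu>" and "f \<in> borel_measurable borel"
    and "\<And>x. x \<in> support_interval \<mu> \<Longrightarrow> \<bar>f x\<bar> \<le> B"
  shows "integrable \<mu> f"
proof -
  interpret prob_space \<mu>
    using assms(1) by (simp add: compactly_supported_prob_def)
  have [measurable_cong]: "sets \<mu> = sets borel"
    using assms(1) by (simp add: compactly_supported_prob_def)
  show ?thesis
  proof (rule integrable_const_bound[where B = B])
    show "AE x in \<mu>. norm (f x) \<le> B"
      using AE_support_interval[OF assms(1)] by eventually_elim (use assms(3) in auto)
    show "f \<in> borel_measurable \<mu>"
      using assms(2) by measurable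
  qed
qed

lemma integrable_resolvent:
  assumes \<mu>: "compactly_supported_prob \<mu>" and z: "z \<notin> support_interval \<mu>"
  shows "integrable \<mu> (\<lambda>x. 1 / (z - x))"
proof -
  obtain d where d: "d > 0" "\<And>x. x \<in> support_interval \<mu> \<Longrightarrow> d \<le> dist z x"
    using separate_point_closed[of "support_interval \<mu>" z] z by (auto simp: support_interval_def)
  have "\<bar>1 / (z - x)\<bar> \<le> 1 / d" if "x \<in> support_interval \<mu>" for x
    using d(1) d(2)[OF that] by (simp add: dist_real_def frac_le)
  then show ?thesis
    by (intro integrable_bounded_on_support[OF \<mu>]) auto
qed

lemma H_transform_strict:
  assumes \<mu>: "compactly_supported_prob \<mu>"
    and "z \<notin> support_interval \<mu>" "z' \<notin> support_interval \<mu>"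
    and "\<And>x. x \<in> support_interval \<mu> \<Longrightarrow> 1 / (z - x) < 1 / (z' - x)"
  shows "H_transform \<mu> z < H_transform \<mu> z'"
proof -
  interpret prob_space \<mu>
    using assms(1) by (simp add: compactly_supported_prob_def)
  show ?thesis
    unfolding H_transform_def
  proof (rule integral_less_AE_space)
    show "AE x in \<mu>. 1 / (z - x) < 1 / (z' - x)"
      using AE_support_interval[OF \<mu>] by eventually_elim (use assms(4) in auto)
    show "emeasure \<mu> (space \<mu>) \<noteq> 0"
      by (simp add: emeasure_space_1)
  qed (use assms integrable_resolvent in auto)
qed

text \<open>Of two distinct points off the support interval, one has a kernel \<open>1 / (z - x)\<close> that is strictly
smaller throughout the interval: on one side of it the kernel is decreasing in \<open>z\<close>, and across it the
kernel changes sign from negative to positive.\<close>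

lemma inj_on_H_transform:
  assumes \<mu>: "compactly_supported_prob \<mu>"
  shows "inj_on (H_transform \<mu>) (- support_interval \<mu>)"
proof (rule linorder_inj_onI')
  fix z z' assume z: "z \<in> - support_interval \<mu>" "z' \<in> - support_interval \<mu>" and less: "z < z'"
  define l u where "l = Inf (measure_support \<mu>)" "u = Sup (measure_support \<mu>)"
  have I: "support_interval \<mu> = {l..u}"
    by (simp add: support_interval_def l_u_def)
  then have "l \<le> u"
    using measure_support_nonempty[OF \<mu>] measure_support_subset[OF \<mu>] by force
  show "H_transform \<mu> z \<noteq> H_transform \<mu> z'"
  proof (cases "z < l \<and> u < z'")
    case True
    have "1 / (z - x) < 1 / (z' - x)" if "x \<in> support_interval \<mu>" for x
    proof -
      have "1 / (z - x) < 0" "0 < 1 / (z' - x)"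
        using that I True by (auto simp: divide_simps)
      then show ?thesis by linarith
    qed
    then show ?thesis
      using H_transform_strict[OF \<mu>, of z z'] z by auto
  next
    case False
    have "1 / (z' - x) < 1 / (z - x)" if "x \<in> support_interval \<mu>" for x
    proof (cases "u < z")
      case True
      then show ?thesis
        using that I less by (auto intro!: divide_strict_left_mono)
    next
      case False
      then have "z' < l"
        using \<open>\<not> (z < l \<and> u < z')\<close> z I less \<open>l \<le> u\<close> by auto
      then show ?thesis
        using that I less by (intro divide_strict_left_mono) (auto intro!: mult_neg_neg)
    qed
    then show ?thesis
      using H_transform_strict[OF \<mu>, of z' z] z by auto
  qed
qed

section \<open>Power series expansion at infinity\<close>

definition moment_fps :: "real measure \<Rightarrow> complex fps" where
  "moment_fps \<mu> = Abs_fps (\<lambda>k. of_real (LINT x|\<mu>. x ^ k))"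

text \<open>The expansion of \<open>H(1/w)\<close> at \<open>w = 0\<close>. Complex coefficients give access to holomorphic inversion.\<close>

definition cauchy_fps :: "real measure \<Rightarrow> complex fps" where
  "cauchy_fps \<mu> = fps_X * moment_fps \<mu>"

lemma nth_cauchy_fps:
  "fps_nth (cauchy_fps \<mu>) n = (if n = 0 then 0 else of_real (LINT x|\<mu>. x ^ (n - 1)))"
  by (simp add: cauchy_fps_def moment_fps_def)

lemma moment_bound:
  assumes \<mu>: "compactly_supported_prob \<mu>" and C: "\<And>x. x \<in> support_interval \<mu> \<Longrightarrow> \<bar>x\<bar> \<le> C"
  shows "integrable \<mu> (\<lambda>x. x ^ k)" "(LINT x|\<mu>. \<bar>x\<bar> ^ k) \<le> C ^ k"
proof -
  interpret prob_space \<mu>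
    using assms(1) by (simp add: compactly_supported_prob_def)
  have b: "\<bar>x ^ k\<bar> \<le> C ^ k" if "x \<in> support_interval \<mu>" for x
    using C[OF that] by (simp add: power_abs power_mono)
  show i: "integrable \<mu> (\<lambda>x. x ^ k)"
    using b by (intro integrable_bounded_on_support[OF \<mu>]) auto
  have "AE x in \<mu>. \<bar>x\<bar> ^ k \<le> C ^ k"
    using AE_support_interval[OF \<mu>] by eventually_elim (use b in \<open>auto simp: power_abs\<close>)
  then have "(LINT x|\<mu>. \<bar>x\<bar> ^ k) \<le> (LINT x|\<mu>. C ^ k)"
    using integrable_abs[OF i] by (intro integral_mono_AE) (auto simp: power_abs)
  then show "(LINT x|\<mu>. \<bar>x\<bar> ^ k) \<le> C ^ k"
    by (simp add: prob_space)
qed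

lemma H_transform_sums:
  assumes \<mu>: "compactly_supported_prob \<mu>" and C: "\<And>x. x \<in> support_interval \<mu> \<Longrightarrow> \<bar>x\<bar> \<le> C"
    and w: "w \<noteq> 0" "\<bar>w\<bar> * C < 1"
  shows "(\<lambda>k. w ^ Suc k * (LINT x|\<mu>. x ^ k)) sums H_transform \<mu> (1 / w)"
proof -
  interpret prob_space \<mu>
    using assms(1) by (simp add: compactly_supported_prob_def)
  note mom = moment_bound[OF \<mu> C]
  have "C \<ge> 0"
    using measure_support_nonempty[OF \<mu>] measure_support_subset[OF \<mu>] C by fastforce
  have small: "\<bar>w * x\<bar> < 1" if "x \<in> support_interval \<mu>" for x
  proof -
    have "\<bar>w\<bar> * \<bar>x\<bar> \<le> \<bar>w\<bar> * C"
      by (intro mult_left_mono C that) auto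
    then show ?thesis
      using w(2) unfolding abs_mult by linarith
  qed
  have "(\<lambda>k. LINT x|\<mu>. w ^ Suc k * x ^ k) sums (LINT x|\<mu>. (\<Sum>k. w ^ Suc k * x ^ k))"
  proof (rule sums_integral)
    show "integrable \<mu> (\<lambda>x. w ^ Suc k * x ^ k)" for k
      using mom(1) by (intro integrable_mult_right)
    show "AE x in \<mu>. summable (\<lambda>k. norm (w ^ Suc k * x ^ k))"
      using AE_support_interval[OF \<mu>]
    proof eventually_elim
      case (elim x)
      have "summable (\<lambda>k. \<bar>w\<bar> * \<bar>w * x\<bar> ^ k)"
        using small[OF elim] by (intro summable_mult summable_geometric) simp
      then show ?case
        by (simp add: abs_mult power_abs power_mult_distrib mult.assoc)
    qed
    show "summable (\<lambda>k. LINT x|\<mu>. norm (w ^ Suc k * x ^ k))"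
    proof (rule summable_comparison_test')
      show "summable (\<lambda>k. \<bar>w\<bar> * (\<bar>w\<bar> * C) ^ k)"
        using w \<open>C \<ge> 0\<close> by (intro summable_mult summable_geometric) simp
      show "norm (LINT x|\<mu>. norm (w ^ Suc k * x ^ k)) \<le> \<bar>w\<bar> * (\<bar>w\<bar> * C) ^ k" for k
      proof -
        have "norm (LINT x|\<mu>. norm (w ^ Suc k * x ^ k)) = \<bar>w\<bar> ^ Suc k * (LINT x|\<mu>. \<bar>x\<bar> ^ k)"
          by (simp add: abs_mult power_abs)
        also have "\<dots> \<le> \<bar>w\<bar> ^ Suc k * C ^ k"
          by (intro mult_left_mono mom(2)) auto
        finally show ?thesis
          by (simp add: power_mult_distrib mult.assoc)
      qed
    qed
  qed
  also have "(LINT x|\<mu>. (\<Sum>k. w ^ Suc k * x ^ k)) = (LINT x|\<mu>. 1 / (1 / w - x))"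
  proof (rule integral_cong_AE)
    have [measurable_cong]: "sets \<mu> = sets borel"
      using \<mu> by (simp add: compactly_supported_prob_def)
    show "(\<lambda>x. \<Sum>k. w ^ Suc k * x ^ k) \<in> borel_measurable \<mu>" "(\<lambda>x. 1 / (1 / w - x)) \<in> borel_measurable \<mu>"
      by measurable
    show "AE x in \<mu>. (\<Sum>k. w ^ Suc k * x ^ k) = 1 / (1 / w - x)"
      using AE_support_interval[OF \<mu>]
    proof eventually_elim
      case (elim x)
      have "(\<lambda>k. w * (w * x) ^ k) sums (w * (1 / (1 - w * x)))"
        using small[OF elim] by (intro sums_mult geometric_sums) simp
      moreover have "w * (1 / (1 - w * x)) = 1 / (1 / w - x)"
        using w(1) small[OF elim] by (simp add: field_simps)
      ultimately show ?case
        by (simp add: power_mult_distrib mult.assoc sums_iff)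
    qed
  qed
  finally show ?thesis
    by (simp add: H_transform_def)
qed

lemma cauchy_fps_conv_radius:
  assumes \<mu>: "compactly_supported_prob \<mu>"
    and C: "C > 0" "\<And>x. x \<in> support_interval \<mu> \<Longrightarrow> \<bar>x\<bar> \<le> C"
  shows "fps_conv_radius (cauchy_fps \<mu>) \<ge> 1 / C"
  unfolding fps_conv_radius_def
proof (rule conv_radius_geI_ex')
  fix r :: real assume r: "0 < r" "ereal r < ereal (1 / C)"
  then have "r * C < 1"
    using C(1) by (simp add: field_simps)
  then have "(\<lambda>k. r ^ Suc k * (LINT x|\<mu>. x ^ k)) sums H_transform \<mu> (1 / r)"
    using r C by (intro H_transform_sums[OF \<mu>, of C]) auto
  then have "summable (\<lambda>k. complex_of_real (r ^ Suc k * (LINT x|\<mu>. x ^ k)))"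
    using sums_of_real sums_summable by blast
  then have "summable (\<lambda>k. fps_nth (cauchy_fps \<mu>) (Suc k) * of_real r ^ Suc k)"
    by (simp add: nth_cauchy_fps mult.commute)
  then show "summable (\<lambda>k. fps_nth (cauchy_fps \<mu>) k * of_real r ^ k)"
    by (subst summable_Suc_iff[symmetric])
qed

lemma cauchy_fps_has_expansion:
  assumes "compactly_supported_prob \<mu>"
  shows "eval_fps (cauchy_fps \<mu>) has_fps_expansion cauchy_fps \<mu>"
proof -
  obtain C where C: "C > 0" "\<And>x. x \<in> support_interval \<mu> \<Longrightarrow> \<bar>x\<bar> \<le> C"
    using support_interval_bounded[OF assms] by blast
  have "0 < ereal (1 / C)"
    using C(1) by simp
  also have "\<dots> \<le> fps_conv_radius (cauchy_fps \<mu>)"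
    by (rule cauchy_fps_conv_radius[OF assms C])
  finally show ?thesis
    by (rule eval_fps_has_fps_expansion)
qed

lemma eventually_H_transform_eq:
  assumes \<mu>: "compactly_supported_prob \<mu>"
  shows "\<forall>\<^sub>F w in nhds 0. w \<noteq> 0 \<longrightarrow>
    1 / w \<notin> support_interval \<mu> \<and>
    of_real (H_transform \<mu> (1 / w)) = eval_fps (cauchy_fps \<mu>) (of_real w)"
proof -
  obtain C where C: "C > 0" "\<And>x. x \<in> support_interval \<mu> \<Longrightarrow> \<bar>x\<bar> \<le> C"
    using support_interval_bounded[OF assms] by blast
  have "\<forall>\<^sub>F w in nhds (0::real). w \<in> ball 0 (1 / C)"
    using C(1) by (intro eventually_nhds_in_open) auto
  then show ?thesis
  proof eventually_elim
    case (elim w)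
    then have wC: "\<bar>w\<bar> * C < 1"
      using C(1) by (simp add: field_simps)
    show ?case
    proof safe
      assume "w \<noteq> 0" "1 / w \<in> support_interval \<mu>"
      from C(2)[OF this(2)] have "1 \<le> \<bar>w\<bar> * C"
        using \<open>w \<noteq> 0\<close> by (simp add: field_simps)
      with wC show False by simp
    next
      assume "w \<noteq> 0"
      have "(\<lambda>k. complex_of_real (w ^ Suc k * (LINT x|\<mu>. x ^ k))) sums of_real (H_transform \<mu> (1 / w))"
        by (intro sums_of_real H_transform_sums[OF \<mu> C(2)] \<open>w \<noteq> 0\<close> wC)
      then have "(\<lambda>k. fps_nth (cauchy_fps \<mu>) (Suc k) * of_real w ^ Suc k) sums of_real (H_transform \<mu> (1 / w))"
        by (simp add: nth_cauchy_fps mult.commute)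
      then have "(\<lambda>k. fps_nth (cauchy_fps \<mu>) k * of_real w ^ k) sums of_real (H_transform \<mu> (1 / w))"
        by (subst (asm) sums_Suc_iff) (simp add: nth_cauchy_fps)
      then show "of_real (H_transform \<mu> (1 / w)) = eval_fps (cauchy_fps \<mu>) (of_real w)"
        by (simp add: eval_fps_def sums_iff)
    qed
  qed
qed

text \<open>The coefficients are real; this is what will force the local inverse to be real on the real axis.\<close>

lemma eval_cauchy_fps_cnj:
  assumes "norm z < fps_conv_radius (cauchy_fps \<mu>)"
  shows "eval_fps (cauchy_fps \<mu>) (cnj z) = cnj (eval_fps (cauchy_fps \<mu>) z)"
proof -
  have "(\<lambda>n. fps_nth (cauchy_fps \<mu>) n * z ^ n) sums eval_fps (cauchy_fps \<mu>) z"
    using assms by (rule sums_eval_fps)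
  then have "(\<lambda>n. cnj (fps_nth (cauchy_fps \<mu>) n * z ^ n)) sums cnj (eval_fps (cauchy_fps \<mu>) z)"
    by (simp only: sums_cnj)
  then have "(\<lambda>n. fps_nth (cauchy_fps \<mu>) n * cnj z ^ n) sums cnj (eval_fps (cauchy_fps \<mu>) z)"
    by (simp add: nth_cauchy_fps if_distrib[of cnj] cong: if_cong)
  then show ?thesis
    by (simp add: eval_fps_def sums_iff)
qed

text \<open>The derivative of the series at \<open>0\<close> is the total mass \<open>1\<close>.\<close>

lemma cauchy_fps_locally_injective:
  assumes \<mu>: "compactly_supported_prob \<mu>"
  obtains S where "open S" "0 \<in> S" "eval_fps (cauchy_fps \<mu>) holomorphic_on S"
    "inj_on (eval_fps (cauchy_fps \<mu>)) S" "\<forall>z\<in>S. cnj z \<in> S"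
    "\<forall>z\<in>S. eval_fps (cauchy_fps \<mu>) (cnj z) = cnj (eval_fps (cauchy_fps \<mu>) z)"
proof -
  let ?g = "eval_fps (cauchy_fps \<mu>)"
  let ?D = "eball (0::complex) (fps_conv_radius (cauchy_fps \<mu>))"
  interpret prob_space \<mu>
    using \<mu> by (simp add: compactly_supported_prob_def)
  note exp = cauchy_fps_has_expansion[OF \<mu>]
  have "fps_nth (cauchy_fps \<mu>) 1 = deriv ?g 0"
    by (subst fps_nth_fps_expansion[OF exp]) simp
  then have deriv: "deriv ?g 0 \<noteq> 0"
    by (simp add: nth_cauchy_fps prob_space)
  have hol: "?g holomorphic_on ?D"
    by (intro holomorphic_intros) auto
  have D0: "0 \<in> ?D"
    using exp by (simp add: has_fps_expansion_def zero_ereal_def)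
  obtain r where r: "r > 0" "ball 0 r \<subseteq> ?D" "inj_on ?g (ball 0 r)"
    using has_complex_derivative_locally_injective[OF hol D0 _ deriv] by blast
  show thesis
  proof (rule that[of "ball 0 r"])
    show "\<forall>z\<in>ball 0 r. ?g (cnj z) = cnj (?g z)"
      using r(2) by (intro ballI eval_cauchy_fps_cnj) (auto simp: in_eball_iff)
  qed (use r hol in \<open>auto intro: holomorphic_on_subset\<close>)
qed

text \<open>The local inverse of the series is a convergent series, obtained as the Taylor expansion of the
holomorphic local inverse. Convergence is what the purely formal inverse would not provide.\<close>

lemma cauchy_fps_inverse_exists:
  assumes \<mu>: "compactly_supported_prob \<mu>"
  obtains f F where "f has_fps_expansion F" "fps_nth F 0 = 0" "cauchy_fps \<mu> oo F = fps_X"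
proof -
  let ?g = "eval_fps (cauchy_fps \<mu>)"
  obtain S where S: "open S" "0 \<in> S" "?g holomorphic_on S" "inj_on ?g S"
    by (rule cauchy_fps_locally_injective[OF \<mu>])
  obtain f where f: "f holomorphic_on (?g ` S)" "\<And>z. z \<in> S \<Longrightarrow> f (?g z) = z"
    by (rule holomorphic_has_inverse[OF S(3,1,4)]) blast
  have op: "open (?g ` S)"
    by (rule open_mapping_thm3[OF S(3,1,4)])
  have g0: "?g 0 = 0"
    by (simp add: eval_fps_at_0 nth_cauchy_fps)
  then have in0: "0 \<in> ?g ` S"
    using S(2) by force
  define F where "F = fps_expansion f 0"
  have "f analytic_on {0}"
    using f(1) op in0 by (auto simp: analytic_at)
  then have F: "f has_fps_expansion F"
    unfolding F_def by (rule analytic_at_imp_has_fps_expansion_0)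
  have "f 0 = 0"
    using f(2)[OF S(2)] g0 by simp
  then have F0: "fps_nth F 0 = 0"
    using fps_nth_fps_expansion[OF F, of 0] by simp
  have "(?g \<circ> f) has_fps_expansion (cauchy_fps \<mu> oo F)"
    by (rule has_fps_expansion_compose[OF cauchy_fps_has_expansion[OF \<mu>] F F0])
  moreover have "\<forall>\<^sub>F u in nhds 0. (?g \<circ> f) u = u"
    using eventually_nhds_in_open[OF op in0] by eventually_elim (use f(2) in auto)
  then have "(?g \<circ> f) has_fps_expansion fps_X"
    using has_fps_expansion_fps_X has_fps_expansion_cong[of "?g \<circ> f" "\<lambda>u. u" fps_X fps_X] by simp
  ultimately have "cauchy_fps \<mu> oo F = fps_X"
    by (rule fps_expansion_unique_complex)
  then show thesis
    using that[OF F F0] by simp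
qed

section \<open>The inverse transform near the origin\<close>

lemma eventually_nhds_of_real:
  assumes "\<forall>\<^sub>F z in nhds (0::complex). P z"
  shows "\<forall>\<^sub>F t in nhds (0::real). P (of_real t)"
proof -
  have "filterlim complex_of_real (nhds 0) (nhds 0)"
    using tendsto_of_real[OF filterlim_ident, of "0::real"] by simp
  then show ?thesis
    using assms by (rule eventually_compose_filterlim[rotated])
qed

text \<open>Near \<open>0\<close> the point \<open>w = f \<theta>\<close> solves \<open>G(w) = \<theta>\<close>. It is real, since \<open>cnj w\<close> is another small solution
and \<open>G\<close> is injective near \<open>0\<close>. So \<open>1 / w\<close> is a real point off the support interval with \<open>H(1/w) = \<theta>\<close>, and
global injectivity of \<open>H\<close> there identifies it with \<open>K(\<theta>)\<close>.\<close>

lemma K_transform_eq_reciprocal: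
  assumes \<mu>: "compactly_supported_prob \<mu>"
    and f: "f has_fps_expansion F" and F0: "fps_nth F 0 = 0" and F: "cauchy_fps \<mu> oo F = fps_X"
  shows "\<forall>\<^sub>F \<theta> in nhds (0::real). \<theta> \<noteq> 0 \<longrightarrow> of_real (K_transform \<mu> \<theta>) = 1 / f (of_real \<theta>)"
proof -
  let ?g = "eval_fps (cauchy_fps \<mu>)"
  obtain S where S: "open S" "0 \<in> S" "?g holomorphic_on S" "inj_on ?g S" "\<forall>z\<in>S. cnj z \<in> S"
    "\<forall>z\<in>S. ?g (cnj z) = cnj (?g z)"
    by (rule cauchy_fps_locally_injective[OF \<mu>])
  have "(?g \<circ> f) has_fps_expansion fps_X"
    using has_fps_expansion_compose[OF cauchy_fps_has_expansion[OF \<mu>] f F0] F by simp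
  then have gf: "\<forall>\<^sub>F u in nhds 0. ?g (f u) = u"
    unfolding has_fps_expansion_def by (auto elim: eventually_mono)
  have lim: "(f \<longlongrightarrow> 0) (nhds 0)"
  proof -
    have f0: "f 0 = 0"
      using has_fps_expansion_imp_0_eq_fps_nth_0[OF f] F0 by simp
    have "f \<midarrow>0\<rightarrow> f 0"
      using has_fps_expansion_imp_continuous[OF f, of UNIV] by (simp only: continuous_within)
    then have "(f \<longlongrightarrow> f 0) (nhds 0)"
      by (rule tendsto_at_iff_tendsto_nhds[THEN iffD1])
    then show ?thesis
      by (simp only: f0)
  qed
  have fS: "\<forall>\<^sub>F u in nhds 0. f u \<in> S"
    using lim S(1,2) by (rule topological_tendstoD)
  have limR: "((\<lambda>t. Re (f (of_real t))) \<longlongrightarrow> 0) (nhds (0::real))"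
  proof -
    have "filterlim complex_of_real (nhds 0) (nhds 0)"
      using tendsto_of_real[OF filterlim_ident, of "0::real"] by simp
    from tendsto_Re[OF filterlim_compose[OF lim this]] show ?thesis
      by simp
  qed
  have H: "\<forall>\<^sub>F t in nhds (0::real). let w = Re (f (of_real t)) in w \<noteq> 0 \<longrightarrow>
      1 / w \<notin> support_interval \<mu> \<and> of_real (H_transform \<mu> (1 / w)) = ?g (of_real w)"
    using eventually_compose_filterlim[OF eventually_H_transform_eq[OF \<mu>] limR] by (simp only: Let_def)
  from eventually_nhds_of_real[OF gf] eventually_nhds_of_real[OF fS] H
  show ?thesis
  proof eventually_elim
    case (elim \<theta>)
    define w where "w = Re (f (of_real \<theta>))"
    have "?g (cnj (f (of_real \<theta>))) = ?g (f (of_real \<theta>))"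
      using bspec[OF S(6) elim(2)] by (simp only: elim(1) complex_cnj_complex_of_real)
    then have "cnj (f (of_real \<theta>)) = f (of_real \<theta>)"
      by (rule inj_onD[OF S(4)]) (use elim(2) S(5) in blast)+
    then have fw: "f (of_real \<theta>) = of_real w"
      by (simp add: w_def complex_eq_iff)
    show ?case
    proof
      assume "\<theta> \<noteq> 0"
      have "?g 0 = 0"
        by (simp add: eval_fps_at_0 nth_cauchy_fps)
      then have "w \<noteq> 0"
        using elim(1) fw \<open>\<theta> \<noteq> 0\<close> by auto
      then have out: "1 / w \<in> - support_interval \<mu>" and H: "of_real (H_transform \<mu> (1 / w)) = ?g (of_real w)"
        using elim(3) by (auto simp: Let_def w_def)
      have "H_transform \<mu> (1 / w) = \<theta>"
        using H elim(1) fw by (metis of_real_eq_iff)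
      then have "K_transform \<mu> \<theta> = 1 / w"
        using inv_into_f_f[OF inj_on_H_transform[OF \<mu>] out] by (simp add: K_transform_def)
      then show "of_real (K_transform \<mu> \<theta>) = 1 / f (of_real \<theta>)"
        by (simp add: fw)
    qed
  qed
qed

text \<open>The inverse series is \<open>X\<close> times a unit; the inverse of this unit is \<open>P = X K(X) = 1 + X R(X)\<close>.\<close>

lemma normalised_inverse_exists:
  assumes \<mu>: "compactly_supported_prob \<mu>"
  obtains p P where "p has_fps_expansion P" "fps_nth P 0 = 1"
    "cauchy_fps \<mu> oo (fps_X * inverse P) = fps_X"
proof -
  interpret prob_space \<mu>
    using \<mu> by (simp add: compactly_supported_prob_def)
  obtain f F where F: "f has_fps_expansion F" "fps_nth F 0 = 0" "cauchy_fps \<mu> oo F = fps_X"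
    by (rule cauchy_fps_inverse_exists[OF \<mu>])
  have "fps_nth (cauchy_fps \<mu> oo F) 1 = 1"
    by (simp add: F(3))
  then have F1: "fps_nth F 1 = 1"
    by (simp add: fps_compose_nth nth_cauchy_fps prob_space)
  define V where "V = fps_shift 1 F"
  have V0: "fps_nth V 0 = 1"
    by (simp add: V_def F1[unfolded One_nat_def])
  have "F \<noteq> 0"
    using F1 by auto
  then have sub: "1 \<le> subdegree F"
    using F(2) by (metis One_nat_def Suc_leI gr0I nth_subdegree_nonzero)
  have FV: "fps_X * V = F"
    using fps_shift_times_fps_X_power[OF sub] by (simp add: V_def mult.commute)
  have "(\<lambda>z. inverse (if z = 0 then fps_nth F 1 else f z / z ^ 1)) has_fps_expansion inverse V"
    unfolding V_def by (intro has_fps_expansion_inverse has_fps_expansion_shift F(1) sub refl)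
      (use F1 in simp)
  moreover have "inverse (inverse V) = V"
    using V0 by simp
  ultimately show thesis
    using that[of _ "inverse V"] V0 F(3) FV by simp
qed

lemma R_transform_eq:
  assumes \<mu>: "compactly_supported_prob \<mu>"
    and p: "p has_fps_expansion P" and P0: "fps_nth P 0 = 1"
    and P: "cauchy_fps \<mu> oo (fps_X * inverse P) = fps_X"
  shows "\<forall>\<^sub>F \<theta> in nhds (0::real). \<theta> \<noteq> 0 \<longrightarrow>
    of_real (R_transform \<mu> \<theta>) = (p (of_real \<theta>) - 1) / of_real \<theta>"
proof -
  have "(\<lambda>z. z * inverse (p z)) has_fps_expansion fps_X * inverse P"
    by (intro has_fps_expansion_mult has_fps_expansion_fps_X has_fps_expansion_inverse p) (simp add: P0)
  then have "\<forall>\<^sub>F \<theta> in nhds (0::real). \<theta> \<noteq> 0 \<longrightarrow>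
      of_real (K_transform \<mu> \<theta>) = 1 / (of_real \<theta> * inverse (p (of_real \<theta>)))"
    by (rule K_transform_eq_reciprocal[OF \<mu> _ _ P]) simp
  then show ?thesis
  proof eventually_elim
    case (elim \<theta>)
    show ?case
    proof
      assume "\<theta> \<noteq> 0"
      with elim have "complex_of_real (K_transform \<mu> \<theta>) = p (of_real \<theta>) / of_real \<theta>"
        by (simp add: divide_inverse)
      with \<open>\<theta> \<noteq> 0\<close> show "of_real (R_transform \<mu> \<theta>) = (p (of_real \<theta>) - 1) / of_real \<theta>"
        by (simp add: R_transform_def diff_divide_distrib)
    qed
  qed
qed

section \<open>Additivity of the R-transform\<close>

lemma (in nc_probability_space) cauchy_series_eq_cauchy_fps:
  "has_distribution c \<mu> \<Longrightarrow> cauchy_series c = cauchy_fps \<mu>"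
  by (simp add: cauchy_series_def cauchy_fps_def moment_series_def moment_fps_def has_distribution_def)

theorem corollary6p1:
  fixes \<mu>A \<mu>B \<mu> :: "real measure"
    and scale :: "complex \<Rightarrow> 'a::ring_1 \<Rightarrow> 'a" and star :: "'a \<Rightarrow> 'a" and \<phi> :: "'a \<Rightarrow> complex"
  assumes "compactly_supported_prob \<mu>A" and "compactly_supported_prob \<mu>B"
    and "nc_probability_space scale star \<phi>"
    and "nc_probability_space.is_free_convolution scale star \<phi> \<mu>B \<mu>A \<mu>"
  shows "\<forall>\<^sub>F \<theta> in nhds 0. R_transform \<mu> \<theta> = R_transform \<mu>A \<theta> + R_transform \<mu>B \<theta>"
proof -
  interpret nc_probability_space scale star \<phi> by fact
  obtain b a where free: "freely_independent (\<lambda>i. if i then b else a) {True, False}"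
    and b: "has_distribution b \<mu>B" and a: "has_distribution a \<mu>A" and ba: "has_distribution (b + a) \<mu>"
    using assms(4) unfolding is_free_convolution_def by blast
  have \<mu>: "compactly_supported_prob \<mu>"
    using ba by (simp add: has_distribution_def)
  obtain p P where p: "p has_fps_expansion P" "fps_nth P 0 = 1"
    "cauchy_fps \<mu>B oo (fps_X * inverse P) = fps_X"
    by (rule normalised_inverse_exists[OF assms(2)])
  obtain q Q where q: "q has_fps_expansion Q" "fps_nth Q 0 = 1"
    "cauchy_fps \<mu>A oo (fps_X * inverse Q) = fps_X"
    by (rule normalised_inverse_exists[OF assms(1)])
  have sum: "cauchy_fps \<mu> oo (fps_X * inverse (P + Q - 1)) = fps_X"
    using cauchy_series_sum_free[OF free p(2) q(2)] p(3) q(3)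
    by (simp only: cauchy_series_eq_cauchy_fps[OF a] cauchy_series_eq_cauchy_fps[OF b]
        cauchy_series_eq_cauchy_fps[OF ba])
  have pq: "(\<lambda>z. p z + q z - 1) has_fps_expansion P + Q - 1"
    by (intro has_fps_expansion_add has_fps_expansion_diff has_fps_expansion_1 p q)
  \<comment> \<open>At \<open>\<theta> = 0\<close> the R-transform is defined separately as the mean, which the state adds.\<close>
  have "R_transform \<mu> 0 = R_transform \<mu>A 0 + R_transform \<mu>B 0"
  proof -
    have "\<phi> c = of_real (LINT x|\<nu>. x)" if "has_distribution c \<nu>" for c \<nu>
    proof -
      have "\<phi> (c ^ 1) = of_real (LINT x|\<nu>. x ^ 1)"
        using that unfolding has_distribution_def by blast
      then show ?thesis
        by simp
    qed
    note mean = this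
    have "complex_of_real (LINT x|\<mu>. x) = \<phi> b + \<phi> a"
      by (simp only: mean[OF ba, symmetric] state_add)
    also have "\<dots> = of_real ((LINT x|\<mu>A. x) + (LINT x|\<mu>B. x))"
      by (simp only: mean[OF a] mean[OF b] of_real_add add.commute)
    finally have "complex_of_real (LINT x|\<mu>. x) = of_real ((LINT x|\<mu>A. x) + (LINT x|\<mu>B. x))" .
    then show ?thesis
      unfolding R_transform_def of_real_eq_iff by simp
  qed
  moreover have "\<forall>\<^sub>F \<theta> in nhds 0. \<theta> \<noteq> 0 \<longrightarrow> R_transform \<mu> \<theta> = R_transform \<mu>A \<theta> + R_transform \<mu>B \<theta>"
  proof -
    have "fps_nth (P + Q - 1) 0 = 1"
      by (simp add: p(2) q(2))
    from R_transform_eq[OF \<mu> pq this sum] R_transform_eq[OF assms(1) q] R_transform_eq[OF assms(2) p]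
    show ?thesis
    proof eventually_elim
      case (elim \<theta>)
      show ?case
      proof
        assume "\<theta> \<noteq> 0"
        with elim have "complex_of_real (R_transform \<mu> \<theta>) = of_real (R_transform \<mu>A \<theta> + R_transform \<mu>B \<theta>)"
          by (simp add: diff_divide_distrib add_divide_distrib)
        then show "R_transform \<mu> \<theta> = R_transform \<mu>A \<theta> + R_transform \<mu>B \<theta>"
          by (simp only: of_real_eq_iff)
      qed
    qed
  qed
  ultimately show ?thesis
    by (elim eventually_mono) metis
qed

end
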